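(* Let $a\colon\mathbb{N}\to(0,1]$ be a function such that for every $p>0$ there exists $n_p\in\mathbb{N}$ with $a(n)\le n^{-p}$ for all $n\ge n_p$. Then $N_a:=\bigcup_{n\in\mathbb{N}}(n,n+a(n))\subset\mathbb{R}$ is not Schwartz equivalent to $N:=\bigcup_{n\in\mathbb{N}}(n,n+1)\subset\mathbb{R}$.
   Context: $\mathbb{N}=\{1,2,3,\dots\}$. $\mathcal{S}(\mathbb{R}^n)$ is the usual Fréchet space of real-valued Schwartz functions on $\mathbb{R}^n$. For an open $U\subset\mathbb{R}^n$, $\mathcal{S}(U)$ is the closed subspace of those $f\in\mathcal{S}(\mathbb{R}^n)$ such that $f$ and all its partial derivatives vanish at every point of $\mathbb{R}^n\setminus U$, with the induced Fréchet topology; its elements are regarded (by restriction) as smooth functions on $U$. Two open subsets $U,V\subset\mathbb{R}^n$ are called Schwartz equivalent if there exists a $C^\infty$-diffeomorphism $\phi\colon U\to V$ such that $s\mapsto s\circ\phi$ is an isomorphism of Fréchet spaces $\mathcal{S}(V)\to\mathcal{S}(U)$. *)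

theory Defs
  imports "HOL-Analysis.Analysis"
begin

text \<open>
  A partial derivative of higher order is given by the list of coordinate directions in which one
  differentiates. For smooth functions the order of the list is irrelevant, so lists of basis
  vectors play the role of multi-indices \<open>\<beta>\<close> in \<open>\<partial>\<^sup>\<beta>\<close>.
\<close>
fun partials :: "'a list \<Rightarrow> ('a::euclidean_space \<Rightarrow> 'b::real_normed_vector) \<Rightarrow> 'a \<Rightarrow> 'b" where
  "partials [] f = f"
| "partials (i # is) f = (\<lambda>x. frechet_derivative (partials is f) (at x) i)"

text \<open>
  Meant for open \<open>U\<close>. Differentiability of the partial derivatives of every order includes their
  continuity, so this is \<open>C\<^sup>\<infinity>\<close>.
\<close>
definition smooth_on :: "'a::euclidean_space set \<Rightarrow> ('a \<Rightarrow> 'b::real_normed_vector) \<Rightarrow> bool" where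
  "smooth_on U f \<longleftrightarrow>
     (\<forall>is. set is \<subseteq> Basis \<longrightarrow> (\<forall>x\<in>U. partials is f differentiable (at x)))"

definition diffeomorphism_on :: "'a::euclidean_space set \<Rightarrow> 'a set \<Rightarrow> ('a \<Rightarrow> 'a) \<Rightarrow> bool" where
  "diffeomorphism_on U V \<phi> \<longleftrightarrow>
     bij_betw \<phi> U V \<and> smooth_on U \<phi> \<and> smooth_on V (inv_into U \<phi>)"

definition monomial :: "('a::euclidean_space \<Rightarrow> nat) \<Rightarrow> 'a \<Rightarrow> real" where
  "monomial \<alpha> x = (\<Prod>b\<in>Basis. (x \<bullet> b) ^ \<alpha> b)"

definition schwartz_functions :: "('a::euclidean_space \<Rightarrow> real) set" where
  "schwartz_functions =
     {f. smooth_on UNIV f \<and>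
         (\<forall>\<alpha> is. set is \<subseteq> Basis \<longrightarrow> bounded (range (\<lambda>x. monomial \<alpha> x * partials is f x)))}"

definition schwartz_seminorm ::
    "('a::euclidean_space \<Rightarrow> nat) \<Rightarrow> 'a list \<Rightarrow> ('a \<Rightarrow> real) \<Rightarrow> real" where
  "schwartz_seminorm \<alpha> is f = (SUP x. \<bar>monomial \<alpha> x * partials is f x\<bar>)"

text \<open>The locally convex topology defined by the seminorms: their open balls form a subbase.\<close>
definition schwartz_topology :: "('a::euclidean_space \<Rightarrow> real) topology" where
  "schwartz_topology = topology_generated_by
     {{g \<in> schwartz_functions. schwartz_seminorm \<alpha> is (\<lambda>x. g x - f x) < e} | f \<alpha> is e.
        f \<in> schwartz_functions \<and> set is \<subseteq> Basis \<and> e > 0}"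

definition schwartz_functions_on :: "'a::euclidean_space set \<Rightarrow> ('a \<Rightarrow> real) set" where
  "schwartz_functions_on U =
     {f \<in> schwartz_functions. \<forall>is. set is \<subseteq> Basis \<longrightarrow> (\<forall>x. x \<notin> U \<longrightarrow> partials is f x = 0)}"

definition schwartz_topology_on :: "'a::euclidean_space set \<Rightarrow> ('a \<Rightarrow> real) topology" where
  "schwartz_topology_on U = subtopology schwartz_topology (schwartz_functions_on U)"

text \<open>Linear homeomorphisms between topological vector spaces of real functions.\<close>
definition function_space_isomorphism ::
    "('a \<Rightarrow> real) topology \<Rightarrow> ('b \<Rightarrow> real) topology \<Rightarrow> (('a \<Rightarrow> real) \<Rightarrow> 'b \<Rightarrow> real) \<Rightarrow> bool" where
  "function_space_isomorphism X Y T \<longleftrightarrow>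
     homeomorphic_map X Y T \<and>
     (\<forall>f\<in>topspace X. \<forall>g\<in>topspace X. T (\<lambda>x. f x + g x) = (\<lambda>y. T f y + T g y)) \<and>
     (\<forall>c. \<forall>f\<in>topspace X. T (\<lambda>x. c * f x) = (\<lambda>y. c * T f y))"

text \<open>
  A function on \<open>U\<close> which is the restriction of an element of \<^term>\<open>schwartz_functions_on U\<close> is
  identified with that element, that is, with its extension by zero.
\<close>
definition pullback :: "'a set \<Rightarrow> ('a \<Rightarrow> 'a) \<Rightarrow> ('a \<Rightarrow> real) \<Rightarrow> 'a \<Rightarrow> real" where
  "pullback U \<phi> s = (\<lambda>x. if x \<in> U then s (\<phi> x) else 0)"

text \<open>A relation between open sets.\<close>
definition schwartz_equivalent :: "'a::euclidean_space set \<Rightarrow> 'a set \<Rightarrow> bool" where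
  "schwartz_equivalent U V \<longleftrightarrow>
     (\<exists>\<phi>. diffeomorphism_on U V \<phi> \<and>
       function_space_isomorphism (schwartz_topology_on V) (schwartz_topology_on U) (pullback U \<phi>))"

end

theory Submission imports Defs begin

text \<open>
  Let \<open>\<phi>\<close> induce an equivalence. The point \<open>\<phi>\<^sup>-\<^sup>1(k + 1/2)\<close> lies in some component
  \<open>(\<tau> k, \<tau> k + a (\<tau> k))\<close>, and \<open>\<tau>\<close> is injective because \<open>\<phi>\<close> maps components into components; hence
  \<open>\<tau> k \<ge> k\<close> for infinitely many \<open>k\<close>. Put \<open>c k = sqrt (a (\<tau> k))\<close> for these \<open>k\<close> and \<open>c k = 0\<close> otherwise.
  This decays rapidly, so for a bump function \<open>g\<close> on \<open>(0, 1)\<close> the sum of the \<open>c k * g (x - k)\<close> is in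
  \<open>\<S>(N)\<close>. Its pullback rises from \<open>0\<close> to \<open>c k * g (1/2)\<close> within distance \<open>a (\<tau> k)\<close>, so its
  derivative is at least \<open>g (1/2) / sqrt (a (\<tau> k))\<close> somewhere, which is unbounded in \<open>k\<close>. Thus the
  pullback does not even map \<open>\<S>(N)\<close> into \<open>\<S>(N\<^sub>a)\<close>.
\<close>

section \<open>Bump functions\<close>

lemma poly_times_exp_minus_tendsto_0:
  "((\<lambda>t::real. poly p t * exp (- t)) \<longlongrightarrow> 0) at_top"
proof -
  have "((\<lambda>t::real. \<Sum>i\<le>degree p. coeff p i * (t ^ i / exp t)) \<longlongrightarrow> (\<Sum>i\<le>degree p. coeff p i * 0)) at_top"
    by (intro tendsto_intros tendsto_power_div_exp_0)
  then show ?thesis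
    by (simp add: poly_altdef sum_distrib_right exp_minus divide_inverse mult.assoc)
qed

text \<open>The polynomial is a parameter because every derivative of exp(-1/x), extended by zero to
  x <= 0, has this shape.\<close>

definition flat :: "real poly \<Rightarrow> real \<Rightarrow> real" where
  "flat p x = (if x > 0 then poly p (1 / x) * exp (- (1 / x)) else 0)"

lemma flat_nonpos [simp]: "x \<le> 0 \<Longrightarrow> flat p x = 0"
  by (simp add: flat_def)

text \<open>For x > 0 the product rule gives (p - p')(1/x) exp(-1/x) / x^2, and the factor
  \<open>[:0, 0, 1:]\<close> is t^2 at t = 1/x.\<close>

lemma has_real_derivative_flat:
  "(flat p has_real_derivative flat ([:0, 0, 1:] * (p - pderiv p)) x) (at x)"
proof -
  consider "x > 0" | "x < 0" | "x = 0" by linarith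
  then show ?thesis
  proof cases
    case 1
    have "((\<lambda>x. poly p (1 / x) * exp (- (1 / x))) has_real_derivative
        flat ([:0, 0, 1:] * (p - pderiv p)) x) (at x)"
      using 1 by (auto intro!: derivative_eq_intros DERIV_chain'[OF _ poly_DERIV]
          simp: flat_def field_simps power2_eq_square)
    then show ?thesis
      by (rule has_field_derivative_transform_within_open[of _ _ _ "{0<..}"])
         (use 1 in \<open>auto simp: flat_def\<close>)
  next
    case 2
    have "((\<lambda>x. 0) has_real_derivative flat ([:0, 0, 1:] * (p - pderiv p)) x) (at x)"
      using 2 by simp
    then show ?thesis
      by (rule has_field_derivative_transform_within_open[of _ _ _ "{..<0}"])
         (use 2 in auto)
  next
    case 3
    \<comment> \<open>The right-hand difference quotient at 0 is t p(t) exp(-t) with t = 1/h, hence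
      the extra factor \<open>[:0, 1:]\<close>.\<close>
    have "((\<lambda>h. poly ([:0, 1:] * p) (inverse h) * exp (- inverse h)) \<longlongrightarrow> 0) (at_right (0::real))"
      by (rule filterlim_compose[OF poly_times_exp_minus_tendsto_0 filterlim_inverse_at_top_right])
    then have "((\<lambda>h. flat p h / h) \<longlongrightarrow> 0) (at_right 0)"
      by (rule tendsto_cong[THEN iffD1, rotated])
         (auto simp: eventually_at_right_less flat_def field_simps intro!: eventually_at_rightI[of _ 1])
    moreover have "((\<lambda>h. flat p h / h) \<longlongrightarrow> 0) (at_left 0)"
      by (rule tendsto_eventually) (auto intro!: eventually_at_leftI[of "-1"])
    ultimately have "((\<lambda>h. flat p h / h) \<longlongrightarrow> 0) (at 0)"
      by (simp add: filterlim_split_at)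
    then show ?thesis
      using 3 by (simp add: has_field_derivative_iff)
  qed
qed

text \<open>Closed under differentiation, so that no formula for higher derivatives is needed.\<close>
inductive flat_on_unit :: "(real \<Rightarrow> real) \<Rightarrow> bool" where
  prod: "flat_on_unit (\<lambda>x. flat p x * flat q (1 - x))"
| diff: "flat_on_unit u \<Longrightarrow> flat_on_unit v \<Longrightarrow> flat_on_unit (\<lambda>x. u x - v x)"

lemma flat_on_unit_eq_0: "flat_on_unit u \<Longrightarrow> x \<le> 0 \<or> x \<ge> 1 \<Longrightarrow> u x = 0"
  by (induction rule: flat_on_unit.induct) auto

text \<open>The product rule turns a generator into a difference of two generators, the sign coming
  from the inner function 1 - x.\<close>

lemma flat_on_unit_derivative:
  assumes "flat_on_unit u"
  shows "\<exists>u'. flat_on_unit u' \<and> (\<forall>x. (u has_real_derivative u' x) (at x))"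
  using assms
proof (induction rule: flat_on_unit.induct)
  case (prod p q)
  let ?d = "\<lambda>p. [:0, 0, 1:] * (p - pderiv p) :: real poly"
  have "((\<lambda>x. flat p x * flat q (1 - x)) has_real_derivative
      flat (?d p) x * flat q (1 - x) - flat p x * flat (?d q) (1 - x)) (at x)" for x
  proof -
    have "((\<lambda>x. flat q (1 - x)) has_real_derivative flat (?d q) (1 - x) * (- 1)) (at x)"
      by (rule DERIV_chain'[OF _ has_real_derivative_flat]) (auto intro!: derivative_eq_intros)
    from DERIV_mult[OF has_real_derivative_flat this] show ?thesis
      by (simp add: algebra_simps)
  qed
  then show ?case
    using flat_on_unit.diff[OF flat_on_unit.prod flat_on_unit.prod] by blast
next
  case (diff u v)
  then show ?case
    by (blast intro: flat_on_unit.diff DERIV_diff)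
qed

text \<open>\<open>G n\<close> is the n-th derivative of exp(-1/x - 1/(1-x)), extended by zero
  outside (0, 1).\<close>

lemma bump_derivatives_exist:
  obtains G :: "nat \<Rightarrow> real \<Rightarrow> real"
  where "\<And>n x. (G n has_real_derivative G (Suc n) x) (at x)"
    and "\<And>n x. x \<le> 0 \<or> x \<ge> 1 \<Longrightarrow> G n x = 0"
    and "G 0 (1 / 2) > 0"
proof -
  define G where "G n = (deriv ^^ n) (\<lambda>x. flat 1 x * flat 1 (1 - x))" for n
  have step: "flat_on_unit (deriv u)" "(u has_real_derivative deriv u x) (at x)"
    if u: "flat_on_unit u" for u x
  proof -
    obtain u' where u': "flat_on_unit u'" "\<And>x. (u has_real_derivative u' x) (at x)"
      using flat_on_unit_derivative[OF u] by blast
    then have "deriv u = u'"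
      by (auto intro: DERIV_imp_deriv)
    with u' show "flat_on_unit (deriv u)" "(u has_real_derivative deriv u x) (at x)"
      by auto
  qed
  have G: "flat_on_unit (G n)" for n
    by (induction n) (auto simp: G_def intro: flat_on_unit.prod step(1))
  show thesis
  proof
    show "(G n has_real_derivative G (Suc n) x) (at x)" for n x
      using step(2)[OF G] by (simp add: G_def)
    show "G n x = 0" if "x \<le> 0 \<or> x \<ge> 1" for n x
      using flat_on_unit_eq_0[OF G that] .
    show "G 0 (1 / 2) > 0"
      by (simp add: G_def flat_def)
  qed
qed

section \<open>Schwartz functions on the line\<close>

text \<open>The only basis vector of the line is 1, so an explicit chain of ordinary derivatives
  determines all iterated partials.\<close>

lemma partials_real:
  fixes F :: "nat \<Rightarrow> real \<Rightarrow> real"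
  assumes F: "\<And>n x. (F n has_real_derivative F (Suc n) x) (at x)" and "set is \<subseteq> Basis"
  shows "partials is (F 0) = F (length is)"
  using assms(2)
proof (induction "is")
  case (Cons i "is")
  have "frechet_derivative (F n) (at x) = (*) (F (Suc n) x)" for n x
    using F[of n x] frechet_derivative_at unfolding has_field_derivative_def by metis
  with Cons show ?case by simp
qed simp

lemma schwartz_functions_realI:
  fixes F :: "nat \<Rightarrow> real \<Rightarrow> real"
  assumes F: "\<And>n x. (F n has_real_derivative F (Suc n) x) (at x)"
    and B: "\<And>n p. bounded (range (\<lambda>x. x ^ p * F n x))"
  shows "F 0 \<in> schwartz_functions"
proof -
  have "F n differentiable at x" for n x
    using F[of n x] unfolding has_field_derivative_def differentiable_def by blast
  then show ?thesis
    using B by (simp add: schwartz_functions_def smooth_on_def partials_real[of F, OF F] monomial_def)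
qed

lemma topspace_schwartz_topology:
  "topspace (schwartz_topology :: ('a::euclidean_space \<Rightarrow> real) topology) = schwartz_functions"
proof -
  let ?ball = "\<lambda>(f :: 'a \<Rightarrow> real) \<alpha> is e. {g \<in> schwartz_functions. schwartz_seminorm \<alpha> is (\<lambda>x. g x - f x) < e}"
  let ?\<B> = "{?ball f \<alpha> is e | f \<alpha> is e. f \<in> schwartz_functions \<and> set is \<subseteq> Basis \<and> e > 0}"
  have "f \<in> \<Union>?\<B>" if f: "f \<in> schwartz_functions" for f :: "'a \<Rightarrow> real"
  proof (rule UnionI)
    \<comment> \<open>Any seminorm and radius would do: each Schwartz function lies in every ball
      centred at itself.\<close>
    show "?ball f (\<lambda>_. 0) [] 1 \<in> ?\<B>"
      using f by (intro CollectI exI conjI refl) auto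
    show "f \<in> ?ball f (\<lambda>_. 0) [] 1"
      using f by (simp add: schwartz_seminorm_def)
  qed
  then have "schwartz_functions \<subseteq> \<Union>?\<B>" by (rule subsetI)
  moreover have "\<Union>?\<B> \<subseteq> schwartz_functions" by (rule Union_least) auto
  ultimately have "\<Union>?\<B> = schwartz_functions" by (rule equalityI[rotated])
  then show ?thesis
    by (simp only: schwartz_topology_def topology_generated_by_topspace)
qed

lemma topspace_schwartz_topology_on: "topspace (schwartz_topology_on U) = schwartz_functions_on U"
proof -
  have "schwartz_functions_on U \<subseteq> schwartz_functions"
    unfolding schwartz_functions_on_def by (rule Collect_restrict)
  then show ?thesis
    unfolding schwartz_topology_on_def topspace_subtopology topspace_schwartz_topology
    by (rule Int_absorb1)
qed

lemma schwartz_equivalent_imp_pullback: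
  assumes "schwartz_equivalent U V"
  obtains \<phi> where "bij_betw \<phi> U V" "continuous_on U \<phi>"
    "\<And>f. f \<in> schwartz_functions_on V \<Longrightarrow> pullback U \<phi> f \<in> schwartz_functions_on U"
proof -
  obtain \<phi> where \<phi>: "diffeomorphism_on U V \<phi>"
      and T: "homeomorphic_map (schwartz_topology_on V) (schwartz_topology_on U) (pullback U \<phi>)"
    using assms by (auto simp: schwartz_equivalent_def function_space_isomorphism_def)
  show thesis
  proof
    show "bij_betw \<phi> U V"
      using \<phi> by (simp add: diffeomorphism_on_def)
    have "\<phi> differentiable at x" if "x \<in> U" for x
    proof -
      have "smooth_on U \<phi>" using \<phi> by (simp add: diffeomorphism_on_def)
      then have "partials [] \<phi> differentiable at x"
        using that unfolding smooth_on_def by (metis empty_set empty_subsetI)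
      then show ?thesis by simp
    qed
    then show "continuous_on U \<phi>"
      by (simp add: continuous_at_imp_continuous_on differentiable_imp_continuous_within)
    show "pullback U \<phi> f \<in> schwartz_functions_on U" if "f \<in> schwartz_functions_on V" for f
      using homeomorphic_imp_surjective_map[OF T] that
      by (auto simp: topspace_schwartz_topology_on)
  qed
qed

text \<open>The case of the trivial monomial and one derivative bounds f' on the whole line; the
  mean value inequality does the rest.\<close>

lemma schwartz_functions_lipschitz:
  fixes f :: "real \<Rightarrow> real"
  assumes "f \<in> schwartz_functions"
  obtains B where "\<And>x y. \<bar>f x - f y\<bar> \<le> B * \<bar>x - y\<bar>"
proof -
  let ?f' = "\<lambda>x. partials [1] f x"
  have diff: "f differentiable at x" for x
  proof -
    have "smooth_on UNIV f" using assms by (simp add: schwartz_functions_def)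
    then have "partials [] f differentiable at x"
      unfolding smooth_on_def by (metis UNIV_I empty_set empty_subsetI)
    then show ?thesis by simp
  qed
  have D: "(f has_real_derivative ?f' x) (at x)" for x
  proof -
    obtain D where D: "(f has_real_derivative D) (at x)"
      using diff[of x] real_differentiable_def by blast
    then have "frechet_derivative f (at x) = (*) D"
      using frechet_derivative_at unfolding has_field_derivative_def by metis
    then show ?thesis
      using D by simp
  qed
  have "bounded (range (\<lambda>x. monomial (\<lambda>_. 0) x * ?f' x))"
  proof -
    have *: "\<forall>\<alpha> is. set is \<subseteq> Basis \<longrightarrow> bounded (range (\<lambda>x. monomial \<alpha> x * partials is f x))"
      using assms by (simp add: schwartz_functions_def)
    show ?thesis
      by (rule *[rule_format]) simp
  qed
  then obtain B where B: "\<And>x. \<bar>?f' x\<bar> \<le> B"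
    by (auto simp: bounded_iff monomial_def)
  show thesis
  proof
    show "\<bar>f x - f y\<bar> \<le> B * \<bar>x - y\<bar>" for x y
      using field_differentiable_bound[of UNIV f ?f' B x y] D B by auto
  qed
qed

text \<open>The functions \<open>\<Sum>\<^sub>k c k * G n (x - k)\<close>: at most one summand is nonzero at a given point.\<close>
lemma schwartz_sum_of_bumps:
  fixes c :: "nat \<Rightarrow> real" and G :: "nat \<Rightarrow> real \<Rightarrow> real"
  assumes G: "\<And>n x. (G n has_real_derivative G (Suc n) x) (at x)"
    and G0: "\<And>n x. x \<le> 0 \<or> x \<ge> 1 \<Longrightarrow> G n x = 0"
    and c0: "c 0 = 0"
    and c: "\<And>p. \<exists>C. \<forall>k. real (k + 1) ^ p * \<bar>c k\<bar> \<le> C"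
  shows "(\<lambda>x. c (nat \<lfloor>x\<rfloor>) * G 0 (x - \<lfloor>x\<rfloor>)) \<in> schwartz_functions_on (\<Union>n\<in>{1..}. {real n <..< real n + 1})"
proof -
  define F where "F n x = c (nat \<lfloor>x\<rfloor>) * G n (x - \<lfloor>x\<rfloor>)" for n and x :: real
  \<comment> \<open>The floor jumps at integers, so near each point \<open>F n\<close> is replaced
    by two translates with fixed coefficients, which can be differentiated termwise.\<close>
  have two_terms: "F n x = c (nat (m - 1)) * G n (x - (m - 1)) + c (nat m) * G n (x - m)"
    if "x \<in> {real_of_int m - 1<..<real_of_int m + 1}" for n x and m :: int
  proof (cases "x < m")
    case True
    then have "\<lfloor>x\<rfloor> = m - 1" using that by (simp add: floor_eq_iff)
    then show ?thesis using True G0[of "x - m" n] by (simp add: F_def)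
  next
    case False
    then have "\<lfloor>x\<rfloor> = m" using that by (simp add: floor_eq_iff)
    then show ?thesis using False G0[of "x - (m - 1)" n] by (simp add: F_def)
  qed
  have F: "(F n has_real_derivative F (Suc n) x) (at x)" for n x
  proof -
    define m where "m = \<lfloor>x\<rfloor>"
    have m: "x \<in> {real_of_int m - 1<..<real_of_int m + 1}"
      unfolding m_def by (auto; linarith)
    have shift: "((\<lambda>x. G n (x - b)) has_real_derivative G (Suc n) (x - b)) (at x)" for b
    proof -
      have "((\<lambda>x. x - b) has_real_derivative 1) (at x)"
        by (auto intro!: derivative_eq_intros)
      from DERIV_chain'[OF this G] show ?thesis by simp
    qed
    have "((\<lambda>x. c (nat (m - 1)) * G n (x - (m - 1)) + c (nat m) * G n (x - m))
        has_real_derivative F (Suc n) x) (at x)"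
      unfolding two_terms[OF m] by (intro DERIV_add DERIV_cmult shift)
    then show ?thesis
      by (rule has_field_derivative_transform_within_open[OF _ _ m]) (simp_all add: two_terms)
  qed
  have G_bounded: "\<exists>B. \<forall>x. \<bar>G n x\<bar> \<le> B" for n
  proof -
    have "continuous_on {0..1} (G n)"
      using G by (intro continuous_at_imp_continuous_on) (blast intro: DERIV_isCont)
    then have "bounded (G n ` {0..1})"
      by (intro compact_imp_bounded compact_continuous_image) auto
    then obtain B where "B > 0" "\<And>x. x \<in> {0..1} \<Longrightarrow> \<bar>G n x\<bar> \<le> B"
      by (auto simp: bounded_pos)
    then have "\<bar>G n x\<bar> \<le> B" for x
      using G0[of x n] by (cases "x \<in> {0..1}") auto
    then show ?thesis by blast
  qed
  have F_bounded: "bounded (range (\<lambda>x. x ^ p * F n x))" for n p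
  proof -
    obtain C where C: "\<And>k. real (k + 1) ^ p * \<bar>c k\<bar> \<le> C" using c by blast
    obtain B where B: "\<And>x. \<bar>G n x\<bar> \<le> B" using G_bounded by blast
    have "C \<ge> 0" using C[of 0] c0 by simp
    have "\<bar>x ^ p * F n x\<bar> \<le> C * B" for x
    proof (cases "x < 0")
      case True
      \<comment> \<open>\<open>nat\<close> sends negative floors to 0, where \<open>c0\<close> makes
        the coefficient vanish.\<close>
      then have "nat \<lfloor>x\<rfloor> = 0" by simp
      then show ?thesis
        using c0 \<open>C \<ge> 0\<close> B[of 0] by (simp add: F_def)
    next
      case False
      then have "\<bar>x\<bar> \<le> real (nat \<lfloor>x\<rfloor> + 1)" by linarith
      then have "\<bar>x\<bar> ^ p * \<bar>c (nat \<lfloor>x\<rfloor>)\<bar> \<le> real (nat \<lfloor>x\<rfloor> + 1) ^ p * \<bar>c (nat \<lfloor>x\<rfloor>)\<bar>"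
        by (intro mult_right_mono power_mono) auto
      also have "\<dots> \<le> C" by (rule C)
      finally have "(\<bar>x\<bar> ^ p * \<bar>c (nat \<lfloor>x\<rfloor>)\<bar>) * \<bar>G n (x - \<lfloor>x\<rfloor>)\<bar> \<le> C * B"
        using B \<open>C \<ge> 0\<close> by (intro mult_mono) auto
      then show ?thesis by (simp add: F_def abs_mult power_abs mult.assoc)
    qed
    then show ?thesis by (auto simp: bounded_iff)
  qed
  have F0: "F n x = 0" if "x \<notin> (\<Union>n\<in>{1..}. {real n <..< real n + 1})" for n x
  \<comment> \<open>Outside the union x is either below 1, where the coefficient is
    \<open>c 0\<close>, or an integer, where \<open>G n 0\<close> vanishes.\<close>
  proof (cases "nat \<lfloor>x\<rfloor> = 0 \<or> x = \<lfloor>x\<rfloor>")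
    case True
    then show ?thesis using c0 G0[of 0 n] by (auto simp: F_def)
  next
    case False
    then have "x \<in> {real (nat \<lfloor>x\<rfloor>) <..< real (nat \<lfloor>x\<rfloor>) + 1}"
      by (auto; linarith)
    moreover have "nat \<lfloor>x\<rfloor> \<in> {1..}"
      using False unfolding atLeast_iff by linarith
    ultimately show ?thesis
      using that by blast
  qed
  have "F 0 \<in> schwartz_functions_on (\<Union>n\<in>{1..}. {real n <..< real n + 1})"
    using schwartz_functions_realI[of F, OF F F_bounded] F0
    by (simp add: schwartz_functions_on_def partials_real[of F, OF F])
  then show ?thesis
    by (simp add: F_def[abs_def])
qed

section \<open>Non-equivalence\<close>

text \<open>Pigeonhole: otherwise \<tau> would inject {1..K} into {1..<K} for large K. Positivity
  matters, as k - 1 shows.\<close>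

lemma inj_on_imp_frequently_ge:
  fixes \<tau> :: "nat \<Rightarrow> nat"
  assumes "inj_on \<tau> {1..}" and pos: "\<And>k. k \<ge> 1 \<Longrightarrow> \<tau> k \<ge> 1"
  shows "\<exists>k\<ge>m. k \<ge> 1 \<and> \<tau> k \<ge> k"
proof (rule ccontr)
  assume "\<not> ?thesis"
  then have less: "\<tau> k < k" if "k \<ge> m" "k \<ge> 1" for k
    using that by force
  \<comment> \<open>Large enough to exceed also the values of \<tau> below \<open>m\<close>, where
    \<open>less\<close> says nothing.\<close>
  define K where "K = Suc (m + Max (\<tau> ` {..m}))"
  have "\<tau> ` {1..K} \<subseteq> {1..<K}"
  proof
    fix y assume "y \<in> \<tau> ` {1..K}"
    then obtain k where k: "k \<in> {1..K}" "y = \<tau> k" by blast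
    have "\<tau> k < K"
    proof (cases "k \<ge> m")
      case True
      then show ?thesis using less[of k] k by auto
    next
      case False
      then have "\<tau> k \<le> Max (\<tau> ` {..m})" by (intro Max_ge) auto
      then show ?thesis by (simp add: K_def)
    qed
    then show "y \<in> {1..<K}" using k pos by auto
  qed
  then have "card {1..K} \<le> card {1..<K}"
    using assms(1) by (intro card_inj_on_le[of \<tau>]) (auto intro: inj_on_subset)
  then show False by (simp add: K_def)
qed

text \<open>Points with different floors have an integer between them, which a connected set would
  contain but the union does not.\<close>

lemma connected_subset_Union_unit_intervals:
  assumes "connected S" "S \<subseteq> (\<Union>n\<in>{1..}. {real n <..< real n + 1})"
    and "x \<in> S" "y \<in> S"
  shows "\<lfloor>x\<rfloor> = \<lfloor>y\<rfloor>"
proof -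
  have *: "\<lfloor>x\<rfloor> = \<lfloor>y\<rfloor>" if "x \<in> S" "y \<in> S" "x \<le> y" for x y
  proof (rule ccontr)
    assume "\<lfloor>x\<rfloor> \<noteq> \<lfloor>y\<rfloor>"
    then have "\<lfloor>x\<rfloor> < \<lfloor>y\<rfloor>"
      using floor_mono[OF \<open>x \<le> y\<close>] by simp
    then have "real_of_int \<lfloor>y\<rfloor> \<in> {x..y}"
      unfolding floor_less_iff by simp
    then have "real_of_int \<lfloor>y\<rfloor> \<in> S"
      using connected_contains_Icc[OF assms(1) that(1,2)] by blast
    then have "real_of_int \<lfloor>y\<rfloor> \<in> (\<Union>n\<in>{1..}. {real n <..< real n + 1})"
      by (rule subsetD[OF assms(2)])
    then obtain n :: nat where n: "real_of_int \<lfloor>y\<rfloor> \<in> {real n <..< real n + 1}"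
      by (rule UN_E)
    have "real_of_int (int n) < real_of_int \<lfloor>y\<rfloor>" "real_of_int \<lfloor>y\<rfloor> < real_of_int (int n + 1)"
      using n unfolding greaterThanLessThan_iff by simp_all
    then have "int n < \<lfloor>y\<rfloor>" "\<lfloor>y\<rfloor> < int n + 1"
      by (simp_all only: of_int_less_iff)
    then show False by linarith
  qed
  show ?thesis
    using *[OF assms(3,4)] *[OF assms(4,3)] linear[of x y] by metis
qed

lemma rapidly_decreasing_sqrt:
  fixes a :: "nat \<Rightarrow> real"
  assumes a: "\<And>n. n \<ge> 1 \<Longrightarrow> 0 < a n \<and> a n \<le> 1"
    and decay: "\<And>p::real. p > 0 \<Longrightarrow> \<exists>m\<ge>1. \<forall>n\<ge>m. a n \<le> real n powr (- p)"
  shows "\<exists>C. \<forall>k\<ge>1. \<forall>n\<ge>k. real (k + 1) ^ p * sqrt (a n) \<le> C"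
proof -
  \<comment> \<open>The square root halves the exponent, hence 2p; adding 2 keeps it positive for p
    = 0.\<close>
  obtain m where m: "m \<ge> 1" "\<And>n. n \<ge> m \<Longrightarrow> a n \<le> real n powr (- real (2 * p + 2))"
    using decay[of "real (2 * p + 2)"] by auto
  have tail: "real n ^ p * sqrt (a n) \<le> 1" if "n \<ge> m" for n
  proof -
    have n: "n \<ge> 1" using that m by simp
    have "a n \<le> 1 / real n ^ (2 * p + 2)"
      using m(2)[OF that] n powr_realpow[of "real n" "2 * p + 2"]
      by (simp add: powr_minus divide_inverse del: of_nat_add of_nat_mult of_nat_Suc power_Suc)
    also have "\<dots> \<le> 1 / real n ^ (2 * p)"
      using n by (intro divide_left_mono power_increasing) auto
    also have "\<dots> = (1 / real n ^ p)\<^sup>2"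
      by (simp add: power_divide power_mult[symmetric] mult.commute)
    finally have "sqrt (a n) \<le> 1 / real n ^ p"
      by (intro real_le_lsqrt) auto
    then show ?thesis using n by (simp add: field_simps)
  qed
  \<comment> \<open>For n >= m, k + 1 <= 2n and \<open>tail\<close> give 2^p; for the remaining n, k
    + 1 <= 2m and a n <= 1 suffice.\<close>
  have "real (k + 1) ^ p * sqrt (a n) \<le> (2 * real m) ^ p" if "k \<ge> 1" "n \<ge> k" for k n
  proof (cases "n \<ge> m")
    case True
    have "real (k + 1) ^ p * sqrt (a n) \<le> (2 * real n) ^ p * sqrt (a n)"
      using that a[of n] by (intro mult_right_mono power_mono) auto
    also have "\<dots> \<le> 2 ^ p * 1"
      unfolding power_mult_distrib mult.assoc using tail[OF True] by (intro mult_left_mono) auto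
    also have "\<dots> \<le> (2 * real m) ^ p"
      using m(1) by (simp add: power_mono)
    finally show ?thesis .
  next
    case False
    have "real (k + 1) ^ p * sqrt (a n) \<le> (2 * real m) ^ p * 1"
      using that False a[of n] by (intro mult_mono power_mono) auto
    then show ?thesis by simp
  qed
  then show ?thesis by blast
qed

theorem mainTheorem7:
  fixes a :: "nat \<Rightarrow> real"
  assumes "\<And>n. n \<ge> 1 \<Longrightarrow> 0 < a n \<and> a n \<le> 1"
    and "\<And>p::real. p > 0 \<Longrightarrow> \<exists>m\<ge>1. \<forall>n\<ge>m. a n \<le> real n powr (- p)"
  shows "\<not> schwartz_equivalent (\<Union>n\<in>{1..}. {real n <..< real n + a n})
                              (\<Union>n\<in>{1..}. {real n <..< real n + 1})"
    (is "\<not> schwartz_equivalent ?U ?V")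
proof
  assume "schwartz_equivalent ?U ?V"
  then obtain \<phi> where bij: "bij_betw \<phi> ?U ?V" and cont: "continuous_on ?U \<phi>"
    and pull: "\<And>f. f \<in> schwartz_functions_on ?V \<Longrightarrow> pullback ?U \<phi> f \<in> schwartz_functions_on ?U"
    using schwartz_equivalent_imp_pullback by blast
  have "\<exists>x n. n \<ge> 1 \<and> x \<in> {real n <..< real n + a n} \<and> \<phi> x = real k + 1 / 2"
    if "k \<ge> 1" for k
  proof -
    have "real k + 1 / 2 \<in> ?V" using that by force
    then have "real k + 1 / 2 \<in> \<phi> ` ?U" using bij by (simp add: bij_betw_def)
    then show ?thesis by force
  qed
  then obtain X \<tau> where \<tau>: "\<And>k. k \<ge> 1 \<Longrightarrow> \<tau> k \<ge> (1::nat)"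
    and X: "\<And>k. k \<ge> 1 \<Longrightarrow> X k \<in> {real (\<tau> k) <..< real (\<tau> k) + a (\<tau> k)}"
    and \<phi>X: "\<And>k. k \<ge> 1 \<Longrightarrow> \<phi> (X k) = real k + 1 / 2"
    by metis
  \<comment> \<open>If \<tau> k = \<tau> l, the image of that one interval is connected and contains
    both midpoints.\<close>
  have "inj_on \<tau> {1..}"
  proof (rule inj_onI)
    fix k l assume kl: "k \<in> {1..}" "l \<in> {1..}" "\<tau> k = \<tau> l"
    let ?I = "{real (\<tau> k) <..< real (\<tau> k) + a (\<tau> k)}"
    have sub: "?I \<subseteq> ?U" using \<tau>[of k] kl by auto
    have "connected (\<phi> ` ?I)"
      by (intro connected_continuous_image continuous_on_subset[OF cont sub]) auto
    moreover have "\<phi> ` ?I \<subseteq> ?V"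
      using image_mono[OF sub] bij_betw_imp_surj_on[OF bij] by metis
    moreover have "real k + 1 / 2 \<in> \<phi> ` ?I" "real l + 1 / 2 \<in> \<phi> ` ?I"
      using X[of k] X[of l] \<phi>X[of k] \<phi>X[of l] kl
      by (auto intro: rev_image_eqI[of "X k"] rev_image_eqI[of "X l"])
    ultimately have "\<lfloor>real k + 1 / 2\<rfloor> = \<lfloor>real l + 1 / 2\<rfloor>"
      by (rule connected_subset_Union_unit_intervals)
    then show "k = l" by linarith
  qed
  then have freq: "\<exists>k\<ge>m. k \<ge> 1 \<and> \<tau> k \<ge> k" for m
    using inj_on_imp_frequently_ge \<tau> by blast

  obtain G :: "nat \<Rightarrow> real \<Rightarrow> real" where G: "\<And>n x. (G n has_real_derivative G (Suc n) x) (at x)"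
    "\<And>n x. x \<le> 0 \<or> x \<ge> 1 \<Longrightarrow> G n x = 0" and Gpos: "G 0 (1 / 2) > 0"
    using bump_derivatives_exist by blast
  define c where "c k = (if k \<ge> 1 \<and> \<tau> k \<ge> k then sqrt (a (\<tau> k)) else 0)" for k
  have "\<exists>C. \<forall>k. real (k + 1) ^ p * \<bar>c k\<bar> \<le> C" for p
  proof -
    obtain C where C: "\<And>k n. k \<ge> 1 \<Longrightarrow> n \<ge> k \<Longrightarrow> real (k + 1) ^ p * sqrt (a n) \<le> C"
      using rapidly_decreasing_sqrt[OF assms] by meson
    \<comment> \<open>The 0 covers the indices with c k = 0, about which \<open>C\<close> says
      nothing.\<close>
    have "real (k + 1) ^ p * \<bar>c k\<bar> \<le> max C 0" for k
      using C[of k "\<tau> k"] assms(1)[of "\<tau> k"] \<tau>[of k] by (auto simp: c_def)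
    then show ?thesis by blast
  qed
  then have "(\<lambda>x. c (nat \<lfloor>x\<rfloor>) * G 0 (x - \<lfloor>x\<rfloor>)) \<in> schwartz_functions_on ?V" (is "?f \<in> _")
    by (intro schwartz_sum_of_bumps G) (auto simp: c_def)
  then have h: "pullback ?U \<phi> ?f \<in> schwartz_functions_on ?U" (is "?h \<in> _")
    by (rule pull)
  then obtain B where B: "\<And>x y. \<bar>?h x - ?h y\<bar> \<le> B * \<bar>x - y\<bar>"
    using schwartz_functions_lipschitz unfolding schwartz_functions_on_def by blast
  have "B \<ge> 0" using B[of 0 1] by auto
  \<comment> \<open>The Lipschitz bound is applied between \<open>X k\<close> and the left endpoint
    of its interval, at distance less than a (\<tau> k); then sqrt (a (\<tau> k)) is
    cancelled.\<close>
  have bound: "G 0 (1 / 2) \<le> B * sqrt (a (\<tau> k))" if k: "k \<ge> 1" "\<tau> k \<ge> k" for k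
  proof -
    have a: "0 < a (\<tau> k)" using assms(1) \<tau> k by blast
    have "X k \<in> ?U" using X[of k] \<tau>[of k] k by blast
    moreover have "\<lfloor>real k + 1 / 2\<rfloor> = int k" by linarith
    ultimately have hX: "?h (X k) = sqrt (a (\<tau> k)) * G 0 (1 / 2)"
      using k \<phi>X[of k] by (simp add: pullback_def c_def)
    \<comment> \<open>Since a n <= 1, no interval of the union contains an integer.\<close>
    have "real (\<tau> k) \<notin> ?U"
    proof
      assume "real (\<tau> k) \<in> ?U"
      then obtain n where "n \<ge> 1" "real n < real (\<tau> k)" "real (\<tau> k) < real n + a n" by auto
      moreover from this have "n < \<tau> k" by simp
      ultimately show False using assms(1)[of n] by linarith
    qed
    then have "?h (real (\<tau> k)) = 0" by (simp only: pullback_def if_False)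
    then have "sqrt (a (\<tau> k)) * G 0 (1 / 2) \<le> B * \<bar>X k - real (\<tau> k)\<bar>"
      using B[of "X k" "real (\<tau> k)"] hX by linarith
    also have "\<dots> \<le> B * a (\<tau> k)"
      using X[of k] k \<open>B \<ge> 0\<close> by (intro mult_left_mono) auto
    also have "\<dots> = sqrt (a (\<tau> k)) * (B * sqrt (a (\<tau> k)))"
      using a by simp
    finally show ?thesis using a by simp
  qed
  \<comment> \<open>The first power suffices: with \<open>bound\<close> it gives (k + 1) G 0 (1/2)
    <= B C for infinitely many k.\<close>
  obtain C where C: "\<And>k n. k \<ge> 1 \<Longrightarrow> n \<ge> k \<Longrightarrow> real (k + 1) ^ 1 * sqrt (a n) \<le> C"
    using rapidly_decreasing_sqrt[OF assms] by meson
  obtain m :: nat where m: "B * C / G 0 (1 / 2) < real m"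
    using reals_Archimedean2 by blast
  obtain k where k: "k \<ge> m" "k \<ge> 1" "\<tau> k \<ge> k" using freq by blast
  have "real (k + 1) * G 0 (1 / 2) \<le> B * (real (k + 1) * sqrt (a (\<tau> k)))"
    using mult_left_mono[OF bound[OF k(2,3)], of "real (k + 1)"] by (simp add: algebra_simps)
  also have "\<dots> \<le> B * C"
    using C[OF k(2,3)] \<open>B \<ge> 0\<close> by (intro mult_left_mono) auto
  also have "\<dots> < real m * G 0 (1 / 2)"
    using m Gpos by (simp add: field_simps)
  also have "\<dots> \<le> real (k + 1) * G 0 (1 / 2)"
    using k Gpos by (intro mult_right_mono) auto
  finally show False by simp
qed

end
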